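(* Let $\mathbb{F}=\mathbb{R}$ or $\mathbb{F}=\mathbb{C}$, let $m\ge n$ be positive integers, and let $T\in\mathbb{F}^{m\times n}$, $S\in\mathbb{F}^{n\times n}$, $W\in\mathbb{F}^{n\times m}$. Put $A=TSW\in\mathbb{F}^{m\times m}$, $B=(WT)S\in\mathbb{F}^{n\times n}$ and $C=S(WT)\in\mathbb{F}^{n\times n}$. Then, as polynomials in $\lambda$, $$\det(\lambda I_m-A)=\lambda^{m-n}\det(\lambda I_n-B)=\lambda^{m-n}\det(\lambda I_n-C).$$ Therefore $A$, $B$ and $C$ have the same nonzero eigenvalues in $\mathbb{C}$, including algebraic multiplicities.
   Context: $I_k$ denotes the $k\times k$ identity matrix. Eigenvalues of a square matrix over $\mathbb{F}$ are its complex eigenvalues, i.e. the roots in $\mathbb{C}$ of its characteristic polynomial; the algebraic multiplicity is the multiplicity as a root of the characteristic polynomial. *)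

theory Defs
  imports "Jordan_Normal_Form.Char_Poly" Complex_Main
begin

text \<open>
  A matrix over \<open>\<real>\<close> or \<open>\<complex>\<close> has its eigenvalues in \<open>\<complex>\<close>. The parameter \<open>\<iota>\<close> is the
  embedding of the entry field into \<open>\<complex>\<close>: \<^const>\<open>complex_of_real\<close> for real matrices and
  \<^const>\<open>id\<close> for complex ones.
\<close>

definition complex_eigenvalues :: "('a::comm_ring_1 \<Rightarrow> complex) \<Rightarrow> 'a mat \<Rightarrow> complex set" where
  "complex_eigenvalues \<iota> A = {z. poly (map_poly \<iota> (char_poly A)) z = 0}"

definition alg_mult :: "('a::comm_ring_1 \<Rightarrow> complex) \<Rightarrow> 'a mat \<Rightarrow> complex \<Rightarrow> nat" where
  "alg_mult \<iota> A z = order z (map_poly \<iota> (char_poly A))"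

end

theory Submission
  imports Defs
begin

text \<open>
  Everything rests on the classical fact that for \<open>P\<close> of size \<open>m \<times> n\<close> and \<open>Q\<close> of size
  \<open>n \<times> m\<close> the products \<open>P Q\<close> and \<open>Q P\<close> have characteristic polynomials differing only by a
  power of \<open>\<lambda>\<close>. The reason is that the two \<open>(m+n) \<times> (m+n)\<close> block matrices

  \<open>[P Q, 0; Q, 0]\<close> and \<open>[0, 0; Q, Q P]\<close>

  are conjugate by the unipotent matrix \<open>[I, P; 0, I]\<close> (lemma \<open>similar_block_products\<close>). Both are
  block lower triangular, so comparing their characteristic polynomials gives
  \<open>\<lambda>^n det(\<lambda>I - P Q) = \<lambda>^m det(\<lambda>I - Q P)\<close>, and \<open>\<lambda>^n\<close> cancels when \<open>n \<le> m\<close>.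

  The identity for \<open>A\<close> and \<open>B\<close> is the case \<open>P = T S\<close>, \<open>Q = W\<close> up to associativity:
  \<open>A = (T S) W\<close> while \<open>W (T S) = (W T) S = B\<close>. The identity for \<open>B\<close> and \<open>C\<close> is the square case
  \<open>P = W T\<close>, \<open>Q = S\<close>. A factor \<open>\<lambda>^k\<close> has no root besides \<open>0\<close>, so it
  affects neither the nonzero roots in \<open>\<complex>\<close> nor their orders.
\<close>

lemma char_poly_zero_mat: "char_poly (0\<^sub>m k k :: 'a::comm_ring_1 mat) = monom 1 k"
proof -
  have "diag_mat (0\<^sub>m k k :: 'a mat) = replicate k 0"
    by (auto simp: diag_mat_def intro: nth_equalityI)
  then show ?thesis
    by (simp add: char_poly_upper_triangular[of _ k] monom_altdef)
qed

lemma char_poly_block_lower_triangular: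
  fixes E :: "'a::idom mat"
  assumes E: "E \<in> carrier_mat m m" and F: "F \<in> carrier_mat n m" and G: "G \<in> carrier_mat n n"
  shows "char_poly (four_block_mat E (0\<^sub>m m n) F G) = char_poly E * char_poly G"
proof -
  have "char_poly_matrix (four_block_mat E (0\<^sub>m m n) F G)
      = four_block_mat (char_poly_matrix E) (0\<^sub>m m n) (map_mat (\<lambda>a. [:- a:]) F) (char_poly_matrix G)"
    using E F G by (intro eq_matI) (auto simp: char_poly_matrix_def)
  then show ?thesis
    using E F G by (simp add: char_poly_def det_four_block_mat_upper_right_zero[of _ m _ n])
qed

text \<open>
  Conjugating by \<open>[I, P; 0, I]\<close> adds a left multiple by \<open>P\<close> of the lower block row to the upper one
  and undoes it on the columns, which carries the product from one diagonal block to the other.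
\<close>

lemma similar_block_products:
  fixes P Q :: "'a::comm_ring_1 mat"
  assumes P: "P \<in> carrier_mat m n" and Q: "Q \<in> carrier_mat n m"
  shows "similar_mat (four_block_mat (P * Q) (0\<^sub>m m n) Q (0\<^sub>m n n))
                     (four_block_mat (0\<^sub>m m m) (0\<^sub>m m n) Q (Q * P))"
    (is "similar_mat ?L ?R")
proof -
  define U where "U = four_block_mat (1\<^sub>m m) P (0\<^sub>m n m) (1\<^sub>m n)"
  define V where "V = four_block_mat (1\<^sub>m m) (- P) (0\<^sub>m n m) (1\<^sub>m n)"
  have neg: "- P \<in> carrier_mat m n" using P by simp
  have [simp]: "- 0\<^sub>m n n = (0\<^sub>m n n :: 'a mat)" by auto
  have UV: "U * V = 1\<^sub>m (m + n)" and VU: "V * U = 1\<^sub>m (m + n)"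
    unfolding U_def V_def using P neg
    by (simp_all add: mult_four_block_mat[of _ m m _ n _ n _ _ m _ n] uminus_l_inv_mat[OF P]
        comm_add_mat[OF P neg])
  have "U * ?R = ?L * U"
    unfolding U_def using P Q
    by (simp add: mult_four_block_mat[of _ m m _ n _ n _ _ m _ n] assoc_mult_mat[of P m n Q m P n])
  moreover have "U \<in> carrier_mat (m + n) (m + n)" "V \<in> carrier_mat (m + n) (m + n)"
    "?L \<in> carrier_mat (m + n) (m + n)" "?R \<in> carrier_mat (m + n) (m + n)"
    unfolding U_def V_def using P Q by auto
  ultimately have "similar_mat_wit ?L ?R U V"
    using UV VU by (intro similar_mat_witI[of _ _ "m + n"])
         (auto simp: assoc_mult_mat[of _ "m + n" "m + n" _ "m + n" _ "m + n"])
  then show ?thesis unfolding similar_mat_def by blast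
qed

lemma char_poly_mult_commute_rectangular:
  fixes P Q :: "'a::idom mat"
  assumes P: "P \<in> carrier_mat m n" and Q: "Q \<in> carrier_mat n m" and le: "n \<le> m"
  shows "char_poly (P * Q) = monom 1 (m - n) * char_poly (Q * P)"
proof -
  have "char_poly (P * Q) * monom 1 n = monom 1 m * char_poly (Q * P)"
    using char_poly_similar[OF similar_block_products[OF P Q]] P Q
    by (simp add: char_poly_block_lower_triangular char_poly_zero_mat)
  also have "monom (1::'a) m = monom 1 n * monom 1 (m - n)"
    using le by (simp add: mult_monom)
  finally have "monom 1 n * char_poly (P * Q) = monom 1 n * (monom 1 (m - n) * char_poly (Q * P))"
    by (simp add: ac_simps)
  then show ?thesis by simp
qed

text \<open>
  Multiplying by \<open>\<lambda>\<^sup>k\<close> changes roots and orders at \<open>0\<close> only. Orders are additive because the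
  remaining factor is nonzero: characteristic polynomials are monic, and a ring homomorphism keeps
  the leading coefficient \<open>1\<close>.
\<close>

lemma
  fixes A B :: "'a::comm_ring_1 mat" and \<iota> :: "'a \<Rightarrow> complex"
  assumes hom: "comm_ring_hom \<iota>" and B: "B \<in> carrier_mat n n"
    and factor: "char_poly A = monom 1 k * char_poly B"
  shows complex_eigenvalues_monom_factor:
      "complex_eigenvalues \<iota> A - {0} = complex_eigenvalues \<iota> B - {0}"
    and alg_mult_monom_factor: "z \<noteq> 0 \<Longrightarrow> alg_mult \<iota> A z = alg_mult \<iota> B z"
proof -
  interpret comm_ring_hom \<iota> by (fact hom)
  interpret poly: map_poly_comm_ring_hom \<iota> ..
  have image: "map_poly \<iota> (char_poly A) = monom 1 k * map_poly \<iota> (char_poly B)"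
    by (simp add: factor hom_distribs)
  then show "complex_eigenvalues \<iota> A - {0} = complex_eigenvalues \<iota> B - {0}"
    by (auto simp: complex_eigenvalues_def poly_monom)
  have "coeff (map_poly \<iota> (char_poly B)) n = 1"
    using degree_monic_char_poly[OF B] by (simp add: coeff_map_poly)
  then have nonzero: "map_poly \<iota> (char_poly B) \<noteq> 0"
    by (metis coeff_0 zero_neq_one)
  show "alg_mult \<iota> A z = alg_mult \<iota> B z" if "z \<noteq> 0"
  proof -
    have "order z (monom 1 k) = 0"
      using that by (intro order_0I) (simp add: poly_monom)
    then show ?thesis
      using nonzero by (simp add: alg_mult_def image order_mult)
  qed
qed

text \<open>
  Real and complex matrices differ only in the embedding \<open>\<iota>\<close> of their entries into \<open>\<complex>\<close>, so one
  argument over an integral domain serves both.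
\<close>

lemma three_factor_product_spectrum:
  fixes T S W :: "'a::idom mat" and \<iota> :: "'a \<Rightarrow> complex"
  assumes hom: "comm_ring_hom \<iota>" and le: "n \<le> m"
    and T: "T \<in> carrier_mat m n" and S: "S \<in> carrier_mat n n" and W: "W \<in> carrier_mat n m"
    and A: "A = T * S * W" and B: "B = (W * T) * S" and C: "C = S * (W * T)"
  shows "char_poly A = monom 1 (m - n) * char_poly B \<and>
         monom 1 (m - n) * char_poly B = monom 1 (m - n) * char_poly C \<and>
         complex_eigenvalues \<iota> A - {0} = complex_eigenvalues \<iota> B - {0} \<and>
         complex_eigenvalues \<iota> B - {0} = complex_eigenvalues \<iota> C - {0} \<and>
         (\<forall>z. z \<noteq> 0 \<longrightarrow>
            alg_mult \<iota> A z = alg_mult \<iota> B z \<and> alg_mult \<iota> B z = alg_mult \<iota> C z)"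
proof -
  have WT: "W * T \<in> carrier_mat n n" and TS: "T * S \<in> carrier_mat m n"
    using T S W by auto
  then have carrier: "B \<in> carrier_mat n n" "C \<in> carrier_mat n n"
    using S by (auto simp: B C)
  have AB: "char_poly A = monom 1 (m - n) * char_poly B"
    using char_poly_mult_commute_rectangular[OF TS W le] assoc_mult_mat[OF W T S]
    by (simp add: A B)
  \<comment> \<open>The trivial factor \<open>\<lambda>\<^sup>0\<close> is kept so that spectra and multiplicities of \<open>B\<close> and \<open>C\<close> compare
      by the same lemmas as those of \<open>A\<close> and \<open>B\<close>.\<close>
  have BC: "char_poly B = monom 1 0 * char_poly C"
    using char_poly_mult_commute_rectangular[OF WT S] by (simp add: B C)
  show ?thesis
    using AB BC complex_eigenvalues_monom_factor[OF hom carrier(1) AB]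
      complex_eigenvalues_monom_factor[OF hom carrier(2) BC]
      alg_mult_monom_factor[OF hom carrier(1) AB] alg_mult_monom_factor[OF hom carrier(2) BC]
    by (simp add: monom_0)
qed

theorem theorem4p1:
  fixes m n :: nat
  assumes "0 < n" and "0 < m" and "n \<le> m"
  shows
    "(\<forall>T S W A B C :: real mat.
        T \<in> carrier_mat m n \<longrightarrow> S \<in> carrier_mat n n \<longrightarrow> W \<in> carrier_mat n m \<longrightarrow>
        A = T * S * W \<longrightarrow> B = (W * T) * S \<longrightarrow> C = S * (W * T) \<longrightarrow>
          char_poly A = monom 1 (m - n) * char_poly B \<and>
          monom 1 (m - n) * char_poly B = monom 1 (m - n) * char_poly C \<and>
          complex_eigenvalues complex_of_real A - {0} = complex_eigenvalues complex_of_real B - {0} \<and>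
          complex_eigenvalues complex_of_real B - {0} = complex_eigenvalues complex_of_real C - {0} \<and>
          (\<forall>z. z \<noteq> 0 \<longrightarrow>
             alg_mult complex_of_real A z = alg_mult complex_of_real B z \<and>
             alg_mult complex_of_real B z = alg_mult complex_of_real C z)) \<and>
     (\<forall>T S W A B C :: complex mat.
        T \<in> carrier_mat m n \<longrightarrow> S \<in> carrier_mat n n \<longrightarrow> W \<in> carrier_mat n m \<longrightarrow>
        A = T * S * W \<longrightarrow> B = (W * T) * S \<longrightarrow> C = S * (W * T) \<longrightarrow>
          char_poly A = monom 1 (m - n) * char_poly B \<and>
          monom 1 (m - n) * char_poly B = monom 1 (m - n) * char_poly C \<and>
          complex_eigenvalues id A - {0} = complex_eigenvalues id B - {0} \<and>
          complex_eigenvalues id B - {0} = complex_eigenvalues id C - {0} \<and>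
          (\<forall>z. z \<noteq> 0 \<longrightarrow>
             alg_mult id A z = alg_mult id B z \<and>
             alg_mult id B z = alg_mult id C z))"
proof -
  have real_hom: "comm_ring_hom complex_of_real" by unfold_locales auto
  have id_hom: "comm_ring_hom (id :: complex \<Rightarrow> complex)" by unfold_locales auto
  show ?thesis
    by (rule conjI; intro allI impI;
        rule three_factor_product_spectrum[OF real_hom \<open>n \<le> m\<close>]
             three_factor_product_spectrum[OF id_hom \<open>n \<le> m\<close>]; assumption)
qed

end
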